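(* Let $\mathbb{A}$ be a symmetric strict monoidal category and let $\mathbf{H}\,\mathcal{C}(\mathbb{A})$ be the strict monoidal category of horizontal cells of its free cornering. Then $\mathbf{H}\,\mathcal{C}(\mathbb{A})$ is spatial; that is, for every object $X$ and every morphism $h:I\to I$ of $\mathbf{H}\,\mathcal{C}(\mathbb{A})$, $h\otimes 1_X=1_X\otimes h$.
   Context: Single-object double categories. A single-object double category $\mathbb{D}$ consists of a monoid $(\mathbb{D}_H,\otimes,I)$ of horizontal edges, a monoid $(\mathbb{D}_V,\otimes,I)$ of vertical edges, and cells $\alpha$, each with a top and a bottom boundary in $\mathbb{D}_H$ and a left and a right boundary in $\mathbb{D}_V$. If the right boundary of $\alpha$ equals the left boundary of $\beta$ there is a horizontal composite $\alpha\vert\beta$ (top/bottom boundaries are multiplied in the order $\alpha,\beta$; left boundary that of $\alpha$, right boundary that of $\beta$). If the bottom boundary of $\alpha$ equals the top boundary of $\beta$ there is a vertical composite $\frac{\alpha}{\beta}$ (left/right boundaries multiplied in the order $\alpha,\beta$; top that of $\alpha$, bottom that of $\beta$). Both compositions are associative and unital, with identity cells $1_A$ for $A\in\mathbb{D}_H$ (top $=$ bottom $=A$, left $=$ right $=I$; identities for vertical composition) and $1_X$ for $X\in\mathbb{D}_V$ (left $=$ right $=X$, top $=$ bottom $=I$; identities for horizontal composition), with $1_A\vert 1_B=1_{A\otimes B}$, $\frac{1_X}{1_Y}=1_{X\otimes Y}$, the two identity cells on $I$ coincide, and the interchange law $\frac{\alpha}{\beta}\big\vert\frac{\gamma}{\delta}=\frac{\alpha\vert\gamma}{\beta\vert\delta}$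 holds. Horizontal cells. $\mathbf{H}\mathbb{D}$ is the strict monoidal category with object set $\mathbb{D}_V$, whose morphisms $X\to Y$ are cells with left boundary $X$, right boundary $Y$ and top and bottom boundary $I$; composition is horizontal composition, and the tensor product is vertical composition, $h\otimes k=\frac{h}{k}$. Free cornering. For a symmetric strict monoidal category $\mathbb{A}$ (with object set $\mathbb{A}_0$), $\mathcal{C}(\mathbb{A})$ is the free single-object double category determined by: horizontal edge monoid $(\mathbb{A}_0,\otimes,I)$; vertical edge monoid the free monoid $\mathbb{A}^{\circ\bullet}=(\mathbb{A}_0\times\{\circ,\bullet\})^*$, with generators written $A^\circ$, $A^\bullet$, product written $\otimes$ and unit $I$; generating cells, for each $A\in\mathbb{A}_0$, the corners (boundaries not mentioned are $I$) - $s^\circ_A$: top $A$, right $A^\circ$; $\quad r^\circ_A$: left $A^\circ$, bottom $A$; - $s^\bullet_A$: top $A$, left $A^\bullet$; $\quad r^\bullet_A$: right $A^\bullet$, bottom $A$; and, for each morphism $f:A\to B$ of $\mathbb{A}$, a cell $\ulcorner f\urcorner$ with top $A$, bottom $B$; subject to the yanking equations $s^\circ_A\vert r^\circ_A=1_A$, $\frac{r^\circ_A}{s^\circ_A}=1_{A^\circ}$, $r^\bullet_A\vert s^\bullet_A=1_A$, $\frac{r^\bullet_A}{s^\bullet_A}=1_{A^\bullet}$, and the equations $\frac{\ulcorner f\urcorner}{\ulcorner g\urcorner}=\ulcorner f;g\urcorner$ (for composable $f,g$; $f;g$ is "first $f$ then $g$"), $\ulcorner 1_A\urcorner=1_A$,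 $\ulcorner f\urcorner\vert\ulcorner g\urcorner=\ulcorner f\otimes g\urcorner$. *)

theory Defs
  imports "HOL-Algebra.Group"
begin

section \<open>Strict monoidal categories\<close>

text \<open>
  Composition \<open>comp\<close> is written in diagrammatic order: \<open>comp M f g\<close> is ``first \<open>f\<close>, then \<open>g\<close>''.
\<close>

record ('o, 'm) monoidal_data =
  obj :: "'o monoid"
  arr :: "'m set"
  src :: "'m \<Rightarrow> 'o"
  tgt :: "'m \<Rightarrow> 'o"
  ident :: "'o \<Rightarrow> 'm"
  comp :: "'m \<Rightarrow> 'm \<Rightarrow> 'm"
  tens :: "'m \<Rightarrow> 'm \<Rightarrow> 'm"

definition homset :: "('o, 'm, 'z) monoidal_data_scheme \<Rightarrow> 'o \<Rightarrow> 'o \<Rightarrow> 'm set" where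
  "homset M X Y = {f \<in> arr M. src M f = X \<and> tgt M f = Y}"

locale strict_monoidal_category =
  fixes M :: "('o, 'm, 'z) monoidal_data_scheme" (structure)
  assumes obj_monoid: "monoid (obj M)"
    and src_closed: "f \<in> arr M \<Longrightarrow> src M f \<in> carrier (obj M)"
    and tgt_closed: "f \<in> arr M \<Longrightarrow> tgt M f \<in> carrier (obj M)"
    and ident_hom: "X \<in> carrier (obj M) \<Longrightarrow> ident M X \<in> homset M X X"
    and comp_hom: "\<lbrakk>f \<in> homset M X Y; g \<in> homset M Y Z\<rbrakk> \<Longrightarrow> comp M f g \<in> homset M X Z"
    and comp_assoc: "\<lbrakk>f \<in> homset M W X; g \<in> homset M X Y; h \<in> homset M Y Z\<rbrakk>
          \<Longrightarrow> comp M (comp M f g) h = comp M f (comp M g h)"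
    and comp_ident_left: "f \<in> homset M X Y \<Longrightarrow> comp M (ident M X) f = f"
    and comp_ident_right: "f \<in> homset M X Y \<Longrightarrow> comp M f (ident M Y) = f"
    and tens_hom: "\<lbrakk>f \<in> homset M X Y; g \<in> homset M X' Y'\<rbrakk>
          \<Longrightarrow> tens M f g \<in> homset M (X \<otimes>\<^bsub>obj M\<^esub> X') (Y \<otimes>\<^bsub>obj M\<^esub> Y')"
    and tens_ident: "\<lbrakk>X \<in> carrier (obj M); Y \<in> carrier (obj M)\<rbrakk>
          \<Longrightarrow> tens M (ident M X) (ident M Y) = ident M (X \<otimes>\<^bsub>obj M\<^esub> Y)"
    and tens_comp: "\<lbrakk>f \<in> homset M X Y; g \<in> homset M Y Z; f' \<in> homset M X' Y'; g' \<in> homset M Y' Z'\<rbrakk>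
          \<Longrightarrow> tens M (comp M f g) (comp M f' g') = comp M (tens M f f') (tens M g g')"
    and tens_assoc: "\<lbrakk>f \<in> arr M; g \<in> arr M; h \<in> arr M\<rbrakk>
          \<Longrightarrow> tens M (tens M f g) h = tens M f (tens M g h)"
    and tens_unit_left: "f \<in> arr M \<Longrightarrow> tens M (ident M \<one>\<^bsub>obj M\<^esub>) f = f"
    and tens_unit_right: "f \<in> arr M \<Longrightarrow> tens M f (ident M \<one>\<^bsub>obj M\<^esub>) = f"

locale spatial_monoidal_category = strict_monoidal_category +
  assumes spatial: "\<lbrakk>X \<in> carrier (obj M); h \<in> homset M \<one>\<^bsub>obj M\<^esub> \<one>\<^bsub>obj M\<^esub>\<rbrakk>
    \<Longrightarrow> tens M h (ident M X) = tens M (ident M X) h"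

record ('o, 'm) symmetric_monoidal_data = "('o, 'm) monoidal_data" +
  braid :: "'o \<Rightarrow> 'o \<Rightarrow> 'm"

text \<open>
  One hexagon suffices, since the other one follows from it by symmetry; the unit law
  \<open>braid A X \<one> = ident A X\<close> follows as well.
\<close>

locale symmetric_strict_monoidal_category =
  strict_monoidal_category A for A :: "('o, 'm, 'z) symmetric_monoidal_data_scheme" (structure) +
  assumes braid_hom: "\<lbrakk>X \<in> carrier (obj A); Y \<in> carrier (obj A)\<rbrakk>
        \<Longrightarrow> braid A X Y \<in> homset A (X \<otimes>\<^bsub>obj A\<^esub> Y) (Y \<otimes>\<^bsub>obj A\<^esub> X)"
    and braid_natural: "\<lbrakk>f \<in> homset A X X'; g \<in> homset A Y Y'\<rbrakk>
        \<Longrightarrow> comp A (tens A f g) (braid A X' Y') = comp A (braid A X Y) (tens A g f)"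
    and braid_involutive: "\<lbrakk>X \<in> carrier (obj A); Y \<in> carrier (obj A)\<rbrakk>
        \<Longrightarrow> comp A (braid A X Y) (braid A Y X) = ident A (X \<otimes>\<^bsub>obj A\<^esub> Y)"
    and braid_hexagon: "\<lbrakk>X \<in> carrier (obj A); Y \<in> carrier (obj A); Z \<in> carrier (obj A)\<rbrakk>
        \<Longrightarrow> braid A X (Y \<otimes>\<^bsub>obj A\<^esub> Z) =
            comp A (tens A (braid A X Y) (ident A Z)) (tens A (ident A Y) (braid A X Z))"


section \<open>Single-object double categories\<close>

record ('h, 'v, 'c) double_data =
  hor :: "'h monoid"
  ver :: "'v monoid"
  cells :: "'c set"
  top_edge :: "'c \<Rightarrow> 'h"
  bot_edge :: "'c \<Rightarrow> 'h"
  left_edge :: "'c \<Rightarrow> 'v"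
  right_edge :: "'c \<Rightarrow> 'v"
  idh :: "'h \<Rightarrow> 'c"  \<comment> \<open>\<open>1\<^sub>A\<close> for a horizontal edge \<open>A\<close>; a unit for vertical composition\<close>
  idv :: "'v \<Rightarrow> 'c"  \<comment> \<open>\<open>1\<^sub>X\<close> for a vertical edge \<open>X\<close>; a unit for horizontal composition\<close>
  hcomp :: "'c \<Rightarrow> 'c \<Rightarrow> 'c"
  vcomp :: "'c \<Rightarrow> 'c \<Rightarrow> 'c"

definition has_boundary ::
    "('h, 'v, 'c, 'z) double_data_scheme \<Rightarrow> 'c \<Rightarrow> 'h \<Rightarrow> 'h \<Rightarrow> 'v \<Rightarrow> 'v \<Rightarrow> bool" where
  "has_boundary D a T B L R \<longleftrightarrow>
     a \<in> cells D \<and> top_edge D a = T \<and> bot_edge D a = B \<and> left_edge D a = L \<and> right_edge D a = R"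

locale single_object_double_category =
  fixes D :: "('h, 'v, 'c, 'z) double_data_scheme" (structure)
  assumes hor_monoid: "monoid (hor D)"
    and ver_monoid: "monoid (ver D)"
    and edges_closed: "a \<in> cells D \<Longrightarrow>
          top_edge D a \<in> carrier (hor D) \<and> bot_edge D a \<in> carrier (hor D) \<and>
          left_edge D a \<in> carrier (ver D) \<and> right_edge D a \<in> carrier (ver D)"
    and idh_boundary: "A \<in> carrier (hor D) \<Longrightarrow>
          has_boundary D (idh D A) A A \<one>\<^bsub>ver D\<^esub> \<one>\<^bsub>ver D\<^esub>"
    and idv_boundary: "X \<in> carrier (ver D) \<Longrightarrow>
          has_boundary D (idv D X) \<one>\<^bsub>hor D\<^esub> \<one>\<^bsub>hor D\<^esub> X X"
    and hcomp_boundary: "\<lbrakk>a \<in> cells D; b \<in> cells D; right_edge D a = left_edge D b\<rbrakk> \<Longrightarrow>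
          has_boundary D (hcomp D a b)
            (top_edge D a \<otimes>\<^bsub>hor D\<^esub> top_edge D b) (bot_edge D a \<otimes>\<^bsub>hor D\<^esub> bot_edge D b)
            (left_edge D a) (right_edge D b)"
    and vcomp_boundary: "\<lbrakk>a \<in> cells D; b \<in> cells D; bot_edge D a = top_edge D b\<rbrakk> \<Longrightarrow>
          has_boundary D (vcomp D a b) (top_edge D a) (bot_edge D b)
            (left_edge D a \<otimes>\<^bsub>ver D\<^esub> left_edge D b) (right_edge D a \<otimes>\<^bsub>ver D\<^esub> right_edge D b)"
    and hcomp_assoc: "\<lbrakk>a \<in> cells D; b \<in> cells D; c \<in> cells D;
          right_edge D a = left_edge D b; right_edge D b = left_edge D c\<rbrakk> \<Longrightarrow>
          hcomp D (hcomp D a b) c = hcomp D a (hcomp D b c)"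
    and vcomp_assoc: "\<lbrakk>a \<in> cells D; b \<in> cells D; c \<in> cells D;
          bot_edge D a = top_edge D b; bot_edge D b = top_edge D c\<rbrakk> \<Longrightarrow>
          vcomp D (vcomp D a b) c = vcomp D a (vcomp D b c)"
    and hcomp_unit_left: "a \<in> cells D \<Longrightarrow> hcomp D (idv D (left_edge D a)) a = a"
    and hcomp_unit_right: "a \<in> cells D \<Longrightarrow> hcomp D a (idv D (right_edge D a)) = a"
    and vcomp_unit_left: "a \<in> cells D \<Longrightarrow> vcomp D (idh D (top_edge D a)) a = a"
    and vcomp_unit_right: "a \<in> cells D \<Longrightarrow> vcomp D a (idh D (bot_edge D a)) = a"
    and hcomp_idh: "\<lbrakk>A \<in> carrier (hor D); B \<in> carrier (hor D)\<rbrakk> \<Longrightarrow>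
          hcomp D (idh D A) (idh D B) = idh D (A \<otimes>\<^bsub>hor D\<^esub> B)"
    and vcomp_idv: "\<lbrakk>X \<in> carrier (ver D); Y \<in> carrier (ver D)\<rbrakk> \<Longrightarrow>
          vcomp D (idv D X) (idv D Y) = idv D (X \<otimes>\<^bsub>ver D\<^esub> Y)"
    and idh_one_eq_idv_one: "idh D \<one>\<^bsub>hor D\<^esub> = idv D \<one>\<^bsub>ver D\<^esub>"
    and interchange: "\<lbrakk>a \<in> cells D; b \<in> cells D; c \<in> cells D; d \<in> cells D;
          bot_edge D a = top_edge D b; bot_edge D c = top_edge D d;
          right_edge D a = left_edge D c; right_edge D b = left_edge D d\<rbrakk> \<Longrightarrow>
          hcomp D (vcomp D a b) (vcomp D c d) = vcomp D (hcomp D a c) (hcomp D b d)"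

text \<open>The strict monoidal category of horizontal cells.\<close>

definition horizontal_cells ::
    "('h, 'v, 'c, 'z) double_data_scheme \<Rightarrow> ('v, 'c) monoidal_data" where
  "horizontal_cells D =
     \<lparr>obj = ver D,
      arr = {a \<in> cells D. top_edge D a = \<one>\<^bsub>hor D\<^esub> \<and> bot_edge D a = \<one>\<^bsub>hor D\<^esub>},
      src = left_edge D,
      tgt = right_edge D,
      ident = idv D,
      comp = hcomp D,
      tens = vcomp D\<rparr>"

lemma (in single_object_double_category) strict_monoidal_category_horizontal_cells:
  "strict_monoidal_category (horizontal_cells D)"
proof -
  interpret H: monoid "hor D" by (rule hor_monoid)
  interpret V: monoid "ver D" by (rule ver_monoid)
  show ?thesis
  proof (rule strict_monoidal_category.intro)
    fix f assume "f \<in> arr (horizontal_cells D)"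
    then have f: "f \<in> cells D" "top_edge D f = \<one>\<^bsub>hor D\<^esub>" "bot_edge D f = \<one>\<^bsub>hor D\<^esub>"
      by (auto simp: horizontal_cells_def)
    show "tens (horizontal_cells D) (ident (horizontal_cells D) \<one>\<^bsub>obj (horizontal_cells D)\<^esub>) f = f"
      using vcomp_unit_left[OF f(1)] f by (simp add: horizontal_cells_def idh_one_eq_idv_one)
    show "tens (horizontal_cells D) f (ident (horizontal_cells D) \<one>\<^bsub>obj (horizontal_cells D)\<^esub>) = f"
      using vcomp_unit_right[OF f(1)] f by (simp add: horizontal_cells_def idh_one_eq_idv_one)
  next
    fix f X Y g X' Y'
    assume "f \<in> homset (horizontal_cells D) X Y" "g \<in> homset (horizontal_cells D) X' Y'"
    then show "tens (horizontal_cells D) f g \<in> homset (horizontal_cells D)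
        (X \<otimes>\<^bsub>obj (horizontal_cells D)\<^esub> X') (Y \<otimes>\<^bsub>obj (horizontal_cells D)\<^esub> Y')"
      using vcomp_boundary[of f g] by (auto simp: horizontal_cells_def homset_def has_boundary_def)
  next
    fix f X Y g Z
    assume "f \<in> homset (horizontal_cells D) X Y" "g \<in> homset (horizontal_cells D) Y Z"
    then show "comp (horizontal_cells D) f g \<in> homset (horizontal_cells D) X Z"
      using hcomp_boundary[of f g] by (auto simp: horizontal_cells_def homset_def has_boundary_def)
  next
    fix X assume "X \<in> carrier (obj (horizontal_cells D))"
    then show "ident (horizontal_cells D) X \<in> homset (horizontal_cells D) X X"
      using idv_boundary[of X] by (auto simp: horizontal_cells_def homset_def has_boundary_def)
  next
    fix f X Y g Z f' X' Y' g' Z'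
    assume "f \<in> homset (horizontal_cells D) X Y" "g \<in> homset (horizontal_cells D) Y Z"
      "f' \<in> homset (horizontal_cells D) X' Y'" "g' \<in> homset (horizontal_cells D) Y' Z'"
    then show "tens (horizontal_cells D) (comp (horizontal_cells D) f g) (comp (horizontal_cells D) f' g') =
       comp (horizontal_cells D) (tens (horizontal_cells D) f f') (tens (horizontal_cells D) g g')"
      using interchange[of f f' g g'] by (auto simp: horizontal_cells_def homset_def)
  qed (use edges_closed hcomp_assoc vcomp_assoc hcomp_unit_left hcomp_unit_right vcomp_idv ver_monoid
      in \<open>auto simp: horizontal_cells_def homset_def\<close>)
qed


section \<open>The free cornering\<close>

text \<open>\<open>(X, White)\<close> stands for \<open>X\<^sup>\<circ>\<close> and \<open>(X, Black)\<close> for \<open>X\<^sup>\<bullet>\<close>.\<close>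

datatype polarity = White | Black

type_synonym 'o vedge = "('o \<times> polarity) list"

definition free_edge_monoid :: "'o set \<Rightarrow> 'o vedge monoid" where
  "free_edge_monoid S = \<lparr>carrier = lists (S \<times> UNIV), mult = (@), one = []\<rparr>"

text \<open>
  The free single-object double category on the given generators and equations is built from formal
  cell expressions modulo the least congruence containing the equations of the presentation and
  the laws of a single-object double category.
\<close>

datatype ('o, 'm) cell_term =
    Box 'm
  | SWhite 'o
  | RWhite 'o
  | SBlack 'o
  | RBlack 'o
  | IdH 'o
  | IdV "'o vedge"
  | HComp "('o, 'm) cell_term" "('o, 'm) cell_term"  (infixl \<open>\<parallel>\<close> 65)
  | VComp "('o, 'm) cell_term" "('o, 'm) cell_term"  (infixl \<open>\<div>\<close> 65)

context
  fixes A :: "('o, 'm, 'z) monoidal_data_scheme" (structure)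
begin

primrec term_top :: "('o, 'm) cell_term \<Rightarrow> 'o" where
  "term_top (Box f) = src A f"
| "term_top (SWhite X) = X"
| "term_top (RWhite X) = \<one>\<^bsub>obj A\<^esub>"
| "term_top (SBlack X) = X"
| "term_top (RBlack X) = \<one>\<^bsub>obj A\<^esub>"
| "term_top (IdH X) = X"
| "term_top (IdV U) = \<one>\<^bsub>obj A\<^esub>"
| "term_top (s \<parallel> t) = term_top s \<otimes>\<^bsub>obj A\<^esub> term_top t"
| "term_top (s \<div> t) = term_top s"

primrec term_bot :: "('o, 'm) cell_term \<Rightarrow> 'o" where
  "term_bot (Box f) = tgt A f"
| "term_bot (SWhite X) = \<one>\<^bsub>obj A\<^esub>"
| "term_bot (RWhite X) = X"
| "term_bot (SBlack X) = \<one>\<^bsub>obj A\<^esub>"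
| "term_bot (RBlack X) = X"
| "term_bot (IdH X) = X"
| "term_bot (IdV U) = \<one>\<^bsub>obj A\<^esub>"
| "term_bot (s \<parallel> t) = term_bot s \<otimes>\<^bsub>obj A\<^esub> term_bot t"
| "term_bot (s \<div> t) = term_bot t"

end

primrec term_left :: "('o, 'm) cell_term \<Rightarrow> 'o vedge" where
  "term_left (Box f) = []"
| "term_left (SWhite X) = []"
| "term_left (RWhite X) = [(X, White)]"
| "term_left (SBlack X) = [(X, Black)]"
| "term_left (RBlack X) = []"
| "term_left (IdH X) = []"
| "term_left (IdV U) = U"
| "term_left (s \<parallel> t) = term_left s"
| "term_left (s \<div> t) = term_left s @ term_left t"

primrec term_right :: "('o, 'm) cell_term \<Rightarrow> 'o vedge" where
  "term_right (Box f) = []"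
| "term_right (SWhite X) = [(X, White)]"
| "term_right (RWhite X) = []"
| "term_right (SBlack X) = []"
| "term_right (RBlack X) = [(X, Black)]"
| "term_right (IdH X) = []"
| "term_right (IdV U) = U"
| "term_right (s \<parallel> t) = term_right t"
| "term_right (s \<div> t) = term_right s @ term_right t"

context
  fixes A :: "('o, 'm, 'z) monoidal_data_scheme" (structure)
begin

primrec wf_term :: "('o, 'm) cell_term \<Rightarrow> bool" where
  "wf_term (Box f) \<longleftrightarrow> f \<in> arr A"
| "wf_term (SWhite X) \<longleftrightarrow> X \<in> carrier (obj A)"
| "wf_term (RWhite X) \<longleftrightarrow> X \<in> carrier (obj A)"
| "wf_term (SBlack X) \<longleftrightarrow> X \<in> carrier (obj A)"
| "wf_term (RBlack X) \<longleftrightarrow> X \<in> carrier (obj A)"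
| "wf_term (IdH X) \<longleftrightarrow> X \<in> carrier (obj A)"
| "wf_term (IdV U) \<longleftrightarrow> U \<in> carrier (free_edge_monoid (carrier (obj A)))"
| "wf_term (s \<parallel> t) \<longleftrightarrow> wf_term s \<and> wf_term t \<and> term_right s = term_left t"
| "wf_term (s \<div> t) \<longleftrightarrow> wf_term s \<and> wf_term t \<and> term_bot A s = term_top A t"

inductive cell_eq :: "('o, 'm) cell_term \<Rightarrow> ('o, 'm) cell_term \<Rightarrow> bool" where
  refl: "wf_term t \<Longrightarrow> cell_eq t t"
| sym: "cell_eq s t \<Longrightarrow> cell_eq t s"
| trans: "\<lbrakk>cell_eq r s; cell_eq s t\<rbrakk> \<Longrightarrow> cell_eq r t"
| hcong: "\<lbrakk>cell_eq s s'; cell_eq t t'; term_right s = term_left t\<rbrakk> \<Longrightarrow> cell_eq (s \<parallel> t) (s' \<parallel> t')"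
| vcong: "\<lbrakk>cell_eq s s'; cell_eq t t'; term_bot A s = term_top A t\<rbrakk> \<Longrightarrow> cell_eq (s \<div> t) (s' \<div> t')"
| hassoc: "wf_term (r \<parallel> s \<parallel> t) \<Longrightarrow> cell_eq (r \<parallel> s \<parallel> t) (r \<parallel> (s \<parallel> t))"
| vassoc: "wf_term (r \<div> s \<div> t) \<Longrightarrow> cell_eq (r \<div> s \<div> t) (r \<div> (s \<div> t))"
| hunit_left: "wf_term t \<Longrightarrow> cell_eq (IdV (term_left t) \<parallel> t) t"
| hunit_right: "wf_term t \<Longrightarrow> cell_eq (t \<parallel> IdV (term_right t)) t"
| vunit_left: "wf_term t \<Longrightarrow> cell_eq (IdH (term_top A t) \<div> t) t"
| vunit_right: "wf_term t \<Longrightarrow> cell_eq (t \<div> IdH (term_bot A t)) t"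
| id_hor: "\<lbrakk>X \<in> carrier (obj A); Y \<in> carrier (obj A)\<rbrakk>
    \<Longrightarrow> cell_eq (IdH X \<parallel> IdH Y) (IdH (X \<otimes>\<^bsub>obj A\<^esub> Y))"
| id_ver: "\<lbrakk>wf_term (IdV U); wf_term (IdV W)\<rbrakk> \<Longrightarrow> cell_eq (IdV U \<div> IdV W) (IdV (U @ W))"
| id_one: "cell_eq (IdH \<one>\<^bsub>obj A\<^esub>) (IdV [])"
| interchange: "\<lbrakk>wf_term (p \<div> q); wf_term (r \<div> s); wf_term (p \<parallel> r); wf_term (q \<parallel> s)\<rbrakk>
    \<Longrightarrow> cell_eq ((p \<div> q) \<parallel> (r \<div> s)) ((p \<parallel> r) \<div> (q \<parallel> s))"
| yank_white_h: "X \<in> carrier (obj A) \<Longrightarrow> cell_eq (SWhite X \<parallel> RWhite X) (IdH X)"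
| yank_white_v: "X \<in> carrier (obj A) \<Longrightarrow> cell_eq (RWhite X \<div> SWhite X) (IdV [(X, White)])"
| yank_black_h: "X \<in> carrier (obj A) \<Longrightarrow> cell_eq (RBlack X \<parallel> SBlack X) (IdH X)"
| yank_black_v: "X \<in> carrier (obj A) \<Longrightarrow> cell_eq (RBlack X \<div> SBlack X) (IdV [(X, Black)])"
| box_comp: "\<lbrakk>f \<in> homset A X Y; g \<in> homset A Y Z\<rbrakk> \<Longrightarrow> cell_eq (Box f \<div> Box g) (Box (comp A f g))"
| box_ident: "X \<in> carrier (obj A) \<Longrightarrow> cell_eq (Box (ident A X)) (IdH X)"
| box_tens: "\<lbrakk>f \<in> arr A; g \<in> arr A\<rbrakk> \<Longrightarrow> cell_eq (Box f \<parallel> Box g) (Box (tens A f g))"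

definition cell_class :: "('o, 'm) cell_term \<Rightarrow> ('o, 'm) cell_term set" where
  "cell_class t = {t'. cell_eq t t'}"

definition rep :: "('o, 'm) cell_term set \<Rightarrow> ('o, 'm) cell_term" where
  "rep c = (SOME t. t \<in> c)"

definition free_cornering :: "('o, 'o vedge, ('o, 'm) cell_term set) double_data" where
  "free_cornering =
     \<lparr>hor = obj A,
      ver = free_edge_monoid (carrier (obj A)),
      cells = {cell_class t | t. wf_term t},
      top_edge = (\<lambda>c. term_top A (rep c)),
      bot_edge = (\<lambda>c. term_bot A (rep c)),
      left_edge = (\<lambda>c. term_left (rep c)),
      right_edge = (\<lambda>c. term_right (rep c)),
      idh = (\<lambda>X. cell_class (IdH X)),
      idv = (\<lambda>U. cell_class (IdV U)),
      hcomp = (\<lambda>c d. cell_class (rep c \<parallel> rep d)),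
      vcomp = (\<lambda>c d. cell_class (rep c \<div> rep d))\<rparr>"

end

text \<open>
  The choice of representatives is immaterial for well-formed terms, and the result is a
  single-object double category.
\<close>

context strict_monoidal_category
begin

lemma wf_term_edges:
  "wf_term M t \<Longrightarrow> term_top M t \<in> carrier (obj M) \<and> term_bot M t \<in> carrier (obj M) \<and>
    term_left t \<in> carrier (free_edge_monoid (carrier (obj M))) \<and>
    term_right t \<in> carrier (free_edge_monoid (carrier (obj M)))"
proof -
  interpret O: monoid "obj M" by (rule obj_monoid)
  show "wf_term M t \<Longrightarrow> ?thesis"
    by (induction t) (auto simp: free_edge_monoid_def src_closed tgt_closed)
qed

lemma cell_eq_boundary:
  "cell_eq M s t \<Longrightarrow> wf_term M s \<and> wf_term M t \<and> term_top M s = term_top M t \<and>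
    term_bot M s = term_bot M t \<and> term_left s = term_left t \<and> term_right s = term_right t"
proof -
  interpret O: monoid "obj M" by (rule obj_monoid)
  show "cell_eq M s t \<Longrightarrow> ?thesis"
  proof (induction rule: cell_eq.induct)
    case (hassoc r s t)
    then show ?case using wf_term_edges[of r] wf_term_edges[of s] wf_term_edges[of t]
      by (auto simp: O.m_assoc)
  next
    case (hunit_left t)
    then show ?case using wf_term_edges[of t] by auto
  next
    case (hunit_right t)
    then show ?case using wf_term_edges[of t] by auto
  next
    case (vunit_left t)
    then show ?case using wf_term_edges[of t] by auto
  next
    case (vunit_right t)
    then show ?case using wf_term_edges[of t] by auto
  next
    case (box_comp f X Y g Z)
    then show ?case using comp_hom[of f X Y g Z] by (auto simp: homset_def)
  next
    case (box_ident X)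
    then show ?case using ident_hom[of X] by (auto simp: homset_def)
  next
    case (box_tens f g)
    then show ?case using tens_hom[of f _ _ g] by (auto simp: homset_def)
  qed (auto simp: free_edge_monoid_def)
qed

lemma cell_class_eq_iff:
  "wf_term M s \<Longrightarrow> cell_class M s = cell_class M t \<longleftrightarrow> cell_eq M s t"
  unfolding cell_class_def using cell_eq.refl cell_eq.sym cell_eq.trans by blast

lemma cell_eq_rep: "wf_term M t \<Longrightarrow> cell_eq M t (rep (cell_class M t))"
  unfolding rep_def cell_class_def
  by (metis cell_eq.refl mem_Collect_eq someI)

lemma rep_boundary:
  assumes "wf_term M t"
  shows "wf_term M (rep (cell_class M t))"
    "term_top M (rep (cell_class M t)) = term_top M t"
    "term_bot M (rep (cell_class M t)) = term_bot M t"
    "term_left (rep (cell_class M t)) = term_left t"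
    "term_right (rep (cell_class M t)) = term_right t"
  using cell_eq_boundary[OF cell_eq_rep[OF assms]] by auto

lemma free_cornering_simps:
  "hor (free_cornering M) = obj M"
  "ver (free_cornering M) = free_edge_monoid (carrier (obj M))"
  "c \<in> cells (free_cornering M) \<longleftrightarrow> (\<exists>t. c = cell_class M t \<and> wf_term M t)"
  "wf_term M t \<Longrightarrow> top_edge (free_cornering M) (cell_class M t) = term_top M t"
  "wf_term M t \<Longrightarrow> bot_edge (free_cornering M) (cell_class M t) = term_bot M t"
  "wf_term M t \<Longrightarrow> left_edge (free_cornering M) (cell_class M t) = term_left t"
  "wf_term M t \<Longrightarrow> right_edge (free_cornering M) (cell_class M t) = term_right t"
  "idh (free_cornering M) X = cell_class M (IdH X)"
  "idv (free_cornering M) U = cell_class M (IdV U)"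
  by (auto simp: free_cornering_def rep_boundary)

lemma hcomp_cell_class:
  assumes "wf_term M (s \<parallel> t)"
  shows "hcomp (free_cornering M) (cell_class M s) (cell_class M t) = cell_class M (s \<parallel> t)"
proof -
  have "cell_eq M (s \<parallel> t) (rep (cell_class M s) \<parallel> rep (cell_class M t))"
    using assms by (intro cell_eq.hcong cell_eq_rep) auto
  then show ?thesis
    using cell_class_eq_iff[OF assms] unfolding free_cornering_def by simp metis
qed

lemma vcomp_cell_class:
  assumes "wf_term M (s \<div> t)"
  shows "vcomp (free_cornering M) (cell_class M s) (cell_class M t) = cell_class M (s \<div> t)"
proof -
  have "cell_eq M (s \<div> t) (rep (cell_class M s) \<div> rep (cell_class M t))"
    using assms by (intro cell_eq.vcong cell_eq_rep) auto
  then show ?thesis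
    using cell_class_eq_iff[OF assms] unfolding free_cornering_def by simp metis
qed

lemma single_object_double_category_free_cornering:
  "single_object_double_category (free_cornering M)"
proof -
  interpret O: monoid "obj M" by (rule obj_monoid)
  let ?C = "free_cornering M"
  have eqI: "cell_class M s = cell_class M t" if "cell_eq M s t" for s t
    using that cell_eq_boundary cell_class_eq_iff by blast
  note fc = free_cornering_simps hcomp_cell_class vcomp_cell_class
  show ?thesis
  proof (rule single_object_double_category.intro)
    fix a assume "a \<in> cells ?C"
    then obtain s where s: "a = cell_class M s" "wf_term M s" by (auto simp: fc)
    note e = wf_term_edges[OF s(2)]
    show "top_edge ?C a \<in> carrier (hor ?C) \<and> bot_edge ?C a \<in> carrier (hor ?C) \<and>
          left_edge ?C a \<in> carrier (ver ?C) \<and> right_edge ?C a \<in> carrier (ver ?C)"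
      using s e by (simp add: fc)
    show "hcomp ?C (idv ?C (left_edge ?C a)) a = a"
      using s e eqI[OF cell_eq.hunit_left[OF s(2)]] by (simp add: fc)
    show "hcomp ?C a (idv ?C (right_edge ?C a)) = a"
      using s e eqI[OF cell_eq.hunit_right[OF s(2)]] by (simp add: fc)
    show "vcomp ?C (idh ?C (top_edge ?C a)) a = a"
      using s e eqI[OF cell_eq.vunit_left[OF s(2)]] by (simp add: fc)
    show "vcomp ?C a (idh ?C (bot_edge ?C a)) = a"
      using s e eqI[OF cell_eq.vunit_right[OF s(2)]] by (simp add: fc)
  next
    fix a b assume "a \<in> cells ?C" "b \<in> cells ?C" and ab: "right_edge ?C a = left_edge ?C b"
    then obtain s t where s: "a = cell_class M s" "wf_term M s" and t: "b = cell_class M t" "wf_term M t"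
      by (auto simp: fc)
    have w: "wf_term M (s \<parallel> t)" using s t ab by (simp add: fc)
    show "has_boundary ?C (hcomp ?C a b) (top_edge ?C a \<otimes>\<^bsub>hor ?C\<^esub> top_edge ?C b)
        (bot_edge ?C a \<otimes>\<^bsub>hor ?C\<^esub> bot_edge ?C b) (left_edge ?C a) (right_edge ?C b)"
      unfolding has_boundary_def using s t w by (auto simp: fc simp del: wf_term.simps)
  next
    fix a b assume "a \<in> cells ?C" "b \<in> cells ?C" and ab: "bot_edge ?C a = top_edge ?C b"
    then obtain s t where s: "a = cell_class M s" "wf_term M s" and t: "b = cell_class M t" "wf_term M t"
      by (auto simp: fc)
    have w: "wf_term M (s \<div> t)" using s t ab by (simp add: fc)
    show "has_boundary ?C (vcomp ?C a b) (top_edge ?C a) (bot_edge ?C b)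
        (left_edge ?C a \<otimes>\<^bsub>ver ?C\<^esub> left_edge ?C b) (right_edge ?C a \<otimes>\<^bsub>ver ?C\<^esub> right_edge ?C b)"
      unfolding has_boundary_def using s t w
      by (auto simp: fc free_edge_monoid_def simp del: wf_term.simps)
  next
    fix a b c assume "a \<in> cells ?C" "b \<in> cells ?C" "c \<in> cells ?C"
      and adj: "right_edge ?C a = left_edge ?C b" "right_edge ?C b = left_edge ?C c"
    then obtain r s t where rst: "a = cell_class M r" "wf_term M r" "b = cell_class M s" "wf_term M s"
        "c = cell_class M t" "wf_term M t"
      by (auto simp: fc)
    have w: "wf_term M (r \<parallel> s \<parallel> t)" using rst adj by (simp add: fc)
    show "hcomp ?C (hcomp ?C a b) c = hcomp ?C a (hcomp ?C b c)"
      using rst w eqI[OF cell_eq.hassoc[OF w]] by (simp add: fc)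
  next
    fix a b c assume "a \<in> cells ?C" "b \<in> cells ?C" "c \<in> cells ?C"
      and adj: "bot_edge ?C a = top_edge ?C b" "bot_edge ?C b = top_edge ?C c"
    then obtain r s t where rst: "a = cell_class M r" "wf_term M r" "b = cell_class M s" "wf_term M s"
        "c = cell_class M t" "wf_term M t"
      by (auto simp: fc)
    have w: "wf_term M (r \<div> s \<div> t)" using rst adj by (simp add: fc)
    show "vcomp ?C (vcomp ?C a b) c = vcomp ?C a (vcomp ?C b c)"
      using rst w eqI[OF cell_eq.vassoc[OF w]] by (simp add: fc)
  next
    fix a b c d assume "a \<in> cells ?C" "b \<in> cells ?C" "c \<in> cells ?C" "d \<in> cells ?C"
      and adj: "bot_edge ?C a = top_edge ?C b" "bot_edge ?C c = top_edge ?C d"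
        "right_edge ?C a = left_edge ?C c" "right_edge ?C b = left_edge ?C d"
    then obtain p q r s where pqrs: "a = cell_class M p" "wf_term M p" "b = cell_class M q" "wf_term M q"
        "c = cell_class M r" "wf_term M r" "d = cell_class M s" "wf_term M s"
      by (auto simp: fc)
    have w: "wf_term M (p \<div> q)" "wf_term M (r \<div> s)" "wf_term M (p \<parallel> r)" "wf_term M (q \<parallel> s)"
      using pqrs adj by (simp_all add: fc)
    show "hcomp ?C (vcomp ?C a b) (vcomp ?C c d) = vcomp ?C (hcomp ?C a c) (hcomp ?C b d)"
      using pqrs w eqI[OF cell_eq.interchange[OF w]] by (simp add: fc)
  next
    show "monoid (ver ?C)"
      by (intro monoidI) (auto simp: fc free_edge_monoid_def)
    show "idh ?C \<one>\<^bsub>hor ?C\<^esub> = idv ?C \<one>\<^bsub>ver ?C\<^esub>"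
      using eqI[OF cell_eq.id_one] by (simp add: fc free_edge_monoid_def)
    fix X assume X: "X \<in> carrier (ver ?C)"
    then show "has_boundary ?C (idv ?C X) \<one>\<^bsub>hor ?C\<^esub> \<one>\<^bsub>hor ?C\<^esub> X X"
      unfolding has_boundary_def by (auto simp: fc)
    fix Y assume Y: "Y \<in> carrier (ver ?C)"
    show "vcomp ?C (idv ?C X) (idv ?C Y) = idv ?C (X \<otimes>\<^bsub>ver ?C\<^esub> Y)"
      using X Y eqI[OF cell_eq.id_ver[of M X Y]] by (simp add: fc free_edge_monoid_def)
  next
    fix X assume X: "X \<in> carrier (hor ?C)"
    then show "has_boundary ?C (idh ?C X) X X \<one>\<^bsub>ver ?C\<^esub> \<one>\<^bsub>ver ?C\<^esub>"
      unfolding has_boundary_def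
      by (auto simp: fc free_edge_monoid_def intro!: exI[of _ "IdH X"])
    fix Y assume Y: "Y \<in> carrier (hor ?C)"
    show "hcomp ?C (idh ?C X) (idh ?C Y) = idh ?C (X \<otimes>\<^bsub>hor ?C\<^esub> Y)"
      using X Y eqI[OF cell_eq.id_hor[of X M Y]] by (simp add: fc)
  qed (simp add: fc obj_monoid)
qed

end

end

theory Submission
  imports Defs
begin

text \<open>
  For every horizontal edge \<open>C\<close> and vertical edge \<open>U\<close> there is a crossing cell \<open>\<chi>\<^sub>U\<close> with top and bottom
  \<open>C\<close> and left and right \<open>U\<close>, built from the corners and the braiding. Every cell \<open>a\<close> slides past
  \<open>C\<close>: composing \<open>\<chi> | a\<close> with the braiding below equals composing the braiding with \<open>a | \<chi>\<close> below, which
  is checked on the generators and is preserved by both compositions. For a cell \<open>h\<close> with trivial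
  boundary, the crossings and braidings involved are identities, so \<open>h | 1\<^sub>C = 1\<^sub>C | h\<close>. Since
  the identity on a generating vertical edge factors as a corner \<open>r\<close> over a corner \<open>s\<close> through \<open>C\<close>, the cell \<open>h\<close>
  passes from above \<open>r\<close> to the side of \<open>C\<close>, across \<open>C\<close>, and out below \<open>s\<close>.
\<close>

section \<open>Cells with trivial boundary\<close>

context single_object_double_category
begin

abbreviation hc (infixl \<open>\<triangleright>\<close> 65) where "a \<triangleright> b \<equiv> hcomp D a b"
abbreviation vc (infixl \<open>\<nabla>\<close> 65) where "a \<nabla> b \<equiv> vcomp D a b"
abbreviation hor_mult (infixl \<open>\<cdot>\<^sub>H\<close> 70) where "X \<cdot>\<^sub>H Y \<equiv> X \<otimes>\<^bsub>hor D\<^esub> Y"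
abbreviation ver_mult (infixl \<open>\<cdot>\<^sub>V\<close> 70) where "U \<cdot>\<^sub>V W \<equiv> U \<otimes>\<^bsub>ver D\<^esub> W"

sublocale H: monoid "hor D" by (rule hor_monoid)
sublocale V: monoid "ver D" by (rule ver_monoid)

section \<open>Boundaries and unit laws in a single-object double category\<close>

lemma hcomp_edges [simp]:
  assumes "a \<in> cells D" "b \<in> cells D" "right_edge D a = left_edge D b"
  shows "a \<triangleright> b \<in> cells D" "top_edge D (a \<triangleright> b) = top_edge D a \<cdot>\<^sub>H top_edge D b"
    "bot_edge D (a \<triangleright> b) = bot_edge D a \<cdot>\<^sub>H bot_edge D b"
    "left_edge D (a \<triangleright> b) = left_edge D a" "right_edge D (a \<triangleright> b) = right_edge D b"
  using hcomp_boundary[OF assms] by (auto simp: has_boundary_def)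

lemma vcomp_edges [simp]:
  assumes "a \<in> cells D" "b \<in> cells D" "bot_edge D a = top_edge D b"
  shows "a \<nabla> b \<in> cells D" "top_edge D (a \<nabla> b) = top_edge D a" "bot_edge D (a \<nabla> b) = bot_edge D b"
    "left_edge D (a \<nabla> b) = left_edge D a \<cdot>\<^sub>V left_edge D b"
    "right_edge D (a \<nabla> b) = right_edge D a \<cdot>\<^sub>V right_edge D b"
  using vcomp_boundary[OF assms] by (auto simp: has_boundary_def)

lemma idh_edges [simp]:
  assumes "X \<in> carrier (hor D)"
  shows "idh D X \<in> cells D" "top_edge D (idh D X) = X" "bot_edge D (idh D X) = X"
    "left_edge D (idh D X) = \<one>\<^bsub>ver D\<^esub>" "right_edge D (idh D X) = \<one>\<^bsub>ver D\<^esub>"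
  using idh_boundary[OF assms] by (auto simp: has_boundary_def)

lemma idv_edges [simp]:
  assumes "U \<in> carrier (ver D)"
  shows "idv D U \<in> cells D" "top_edge D (idv D U) = \<one>\<^bsub>hor D\<^esub>" "bot_edge D (idv D U) = \<one>\<^bsub>hor D\<^esub>"
    "left_edge D (idv D U) = U" "right_edge D (idv D U) = U"
  using idv_boundary[OF assms] by (auto simp: has_boundary_def)

lemma edges_in_carrier [simp]:
  assumes "a \<in> cells D"
  shows "top_edge D a \<in> carrier (hor D)" "bot_edge D a \<in> carrier (hor D)"
    "left_edge D a \<in> carrier (ver D)" "right_edge D a \<in> carrier (ver D)"
  using edges_closed[OF assms] by auto

lemma vcomp_idh_left [simp]: "a \<in> cells D \<Longrightarrow> top_edge D a = X \<Longrightarrow> idh D X \<nabla> a = a"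
  using vcomp_unit_left by blast

lemma vcomp_idh_right [simp]: "a \<in> cells D \<Longrightarrow> bot_edge D a = X \<Longrightarrow> a \<nabla> idh D X = a"
  using vcomp_unit_right by blast

lemma hcomp_idv_left [simp]: "a \<in> cells D \<Longrightarrow> left_edge D a = U \<Longrightarrow> idv D U \<triangleright> a = a"
  using hcomp_unit_left by blast

lemma hcomp_idv_right [simp]: "a \<in> cells D \<Longrightarrow> right_edge D a = U \<Longrightarrow> a \<triangleright> idv D U = a"
  using hcomp_unit_right by blast

lemma hcomp_idh_one_left [simp]:
  "a \<in> cells D \<Longrightarrow> left_edge D a = \<one>\<^bsub>ver D\<^esub> \<Longrightarrow> idh D \<one>\<^bsub>hor D\<^esub> \<triangleright> a = a"
  by (simp add: idh_one_eq_idv_one)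

lemma hcomp_idh_one_right [simp]:
  "a \<in> cells D \<Longrightarrow> right_edge D a = \<one>\<^bsub>ver D\<^esub> \<Longrightarrow> a \<triangleright> idh D \<one>\<^bsub>hor D\<^esub> = a"
  by (simp add: idh_one_eq_idv_one)

text \<open>Pad \<open>a\<close> below and \<open>b\<close> above by vertical identities and
  interchange; the identities fit because the shared edge is trivial. Together with the mirror
  version below, two cells side by side can be stacked in either order.\<close>

lemma hcomp_eq_left_first:
  assumes "a \<in> cells D" "b \<in> cells D" "right_edge D a = \<one>\<^bsub>ver D\<^esub>" "left_edge D b = \<one>\<^bsub>ver D\<^esub>"
  shows "a \<triangleright> b = (a \<triangleright> idh D (top_edge D b)) \<nabla> (idh D (bot_edge D a) \<triangleright> b)"
  using interchange[of a "idh D (bot_edge D a)" "idh D (top_edge D b)" b] assms by simp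

lemma hcomp_eq_right_first:
  assumes "a \<in> cells D" "b \<in> cells D" "right_edge D a = \<one>\<^bsub>ver D\<^esub>" "left_edge D b = \<one>\<^bsub>ver D\<^esub>"
  shows "a \<triangleright> b = (idh D (top_edge D a) \<triangleright> b) \<nabla> (a \<triangleright> idh D (bot_edge D b))"
  using interchange[of "idh D (top_edge D a)" a b "idh D (bot_edge D b)"] assms by simp

text \<open>These are exactly the endomorphisms of the unit object in
  \<open>horizontal_cells D\<close>.\<close>

definition trivial_cell :: "'c \<Rightarrow> bool" where
  "trivial_cell h \<longleftrightarrow> has_boundary D h \<one>\<^bsub>hor D\<^esub> \<one>\<^bsub>hor D\<^esub> \<one>\<^bsub>ver D\<^esub> \<one>\<^bsub>ver D\<^esub>"

lemma trivial_cell_edges: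
  assumes "trivial_cell h"
  shows "h \<in> cells D" "top_edge D h = \<one>\<^bsub>hor D\<^esub>" "bot_edge D h = \<one>\<^bsub>hor D\<^esub>"
    "left_edge D h = \<one>\<^bsub>ver D\<^esub>" "right_edge D h = \<one>\<^bsub>ver D\<^esub>"
  using assms by (auto simp: trivial_cell_def has_boundary_def)

text \<open>The free side of \<open>r\<close> is the right one, that of \<open>s\<close> the left
  one. Hence \<open>h\<close> emerges below \<open>r\<close> on the right of \<open>C\<close> but
  has to enter \<open>s\<close> from the left of \<open>C\<close>; \<open>comm\<close> bridges this
  gap.\<close>

lemma trivial_cell_through_white:
  assumes h: "trivial_cell h" and C: "C \<in> carrier (hor D)"
    and r: "has_boundary D r \<one>\<^bsub>hor D\<^esub> C U \<one>\<^bsub>ver D\<^esub>"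
    and s: "has_boundary D s C \<one>\<^bsub>hor D\<^esub> \<one>\<^bsub>ver D\<^esub> U"
    and comm: "h \<triangleright> idh D C = idh D C \<triangleright> h"
  shows "h \<nabla> (r \<nabla> s) = (r \<nabla> s) \<nabla> h"
proof -
  note rs [simp] = r[unfolded has_boundary_def] s[unfolded has_boundary_def]
  note [simp] = trivial_cell_edges[OF h] C
  have U [simp]: "U \<in> carrier (ver D)"
    using edges_in_carrier(3)[of r] by (simp del: edges_in_carrier)
  \<comment> \<open>Both sides are stackings of \<open>r \<triangleright> h\<close>.\<close>
  have "h \<nabla> r = r \<nabla> (idh D C \<triangleright> h)"
    using hcomp_eq_left_first[of r h] hcomp_eq_right_first[of r h] by simp
  moreover have "(h \<triangleright> idh D C) \<nabla> s = s \<nabla> h"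
    using hcomp_eq_left_first[of h s] hcomp_eq_right_first[of h s] by simp
  ultimately show ?thesis
    using comm by (metis vcomp_assoc rs trivial_cell_edges[OF h] hcomp_edges(1-4) idh_edges C H.r_one H.l_one)
qed

text \<open>Mirror image of the white case: \<open>h\<close> emerges on the left of \<open>C\<close>
  and has to be carried to its right.\<close>

lemma trivial_cell_through_black:
  assumes h: "trivial_cell h" and C: "C \<in> carrier (hor D)"
    and r: "has_boundary D r \<one>\<^bsub>hor D\<^esub> C \<one>\<^bsub>ver D\<^esub> U"
    and s: "has_boundary D s C \<one>\<^bsub>hor D\<^esub> U \<one>\<^bsub>ver D\<^esub>"
    and comm: "h \<triangleright> idh D C = idh D C \<triangleright> h"
  shows "h \<nabla> (r \<nabla> s) = (r \<nabla> s) \<nabla> h"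
proof -
  note rs [simp] = r[unfolded has_boundary_def] s[unfolded has_boundary_def]
  note [simp] = trivial_cell_edges[OF h] C
  have "h \<nabla> r = r \<nabla> (h \<triangleright> idh D C)"
    using hcomp_eq_left_first[of h r] hcomp_eq_right_first[of h r] by simp
  moreover have "(idh D C \<triangleright> h) \<nabla> s = s \<nabla> h"
    using hcomp_eq_left_first[of s h] hcomp_eq_right_first[of s h] by simp
  ultimately show ?thesis
    using comm by (metis vcomp_assoc rs trivial_cell_edges[OF h] hcomp_edges(1-4) idh_edges C H.r_one H.l_one)
qed

end

section \<open>Sliding cells past a horizontal edge\<close>

text \<open>\<open>\<sigma>\<close> carries \<open>C\<close> past horizontal edges and
  \<open>\<chi>\<close> carries it past vertical ones. The assumptions concern edges only;
  compatibility with cells is the predicate \<open>slides\<close>, so that it can be established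
  cell by cell.\<close>

locale crossing = single_object_double_category D
  for D :: "('h, 'v, 'c, 'z) double_data_scheme" (structure) +
  fixes C :: 'h and \<sigma> :: "'h \<Rightarrow> 'c" and \<chi> :: "'v \<Rightarrow> 'c"
  assumes C [simp]: "C \<in> carrier (hor D)"
    and braid_boundary: "X \<in> carrier (hor D) \<Longrightarrow>
      has_boundary D (\<sigma> X) (C \<cdot>\<^sub>H X) (X \<cdot>\<^sub>H C) \<one>\<^bsub>ver D\<^esub> \<one>\<^bsub>ver D\<^esub>"
    and crossing_boundary: "U \<in> carrier (ver D) \<Longrightarrow> has_boundary D (\<chi> U) C C U U"
    and braid_one: "\<sigma> \<one>\<^bsub>hor D\<^esub> = idh D C"
    and braid_mult: "\<lbrakk>X \<in> carrier (hor D); Y \<in> carrier (hor D)\<rbrakk> \<Longrightarrow>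
      \<sigma> (X \<cdot>\<^sub>H Y) = (\<sigma> X \<triangleright> idh D Y) \<nabla> (idh D X \<triangleright> \<sigma> Y)"
    and crossing_one: "\<chi> \<one>\<^bsub>ver D\<^esub> = idh D C"
    and crossing_mult: "\<lbrakk>U \<in> carrier (ver D); W \<in> carrier (ver D)\<rbrakk> \<Longrightarrow> \<chi> (U \<cdot>\<^sub>V W) = \<chi> U \<nabla> \<chi> W"
begin

text \<open>Naturality of \<open>\<sigma>\<close> and \<open>\<chi>\<close> at \<open>a\<close>: the
  double-categorical form of a half-braiding with \<open>C\<close>.\<close>

definition slides :: "'c \<Rightarrow> bool" where
  "slides a \<longleftrightarrow> a \<in> cells D \<and>
     (\<chi> (left_edge D a) \<triangleright> a) \<nabla> \<sigma> (bot_edge D a) = \<sigma> (top_edge D a) \<nabla> (a \<triangleright> \<chi> (right_edge D a))"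

lemma braid_edges [simp]:
  assumes "X \<in> carrier (hor D)"
  shows "\<sigma> X \<in> cells D" "top_edge D (\<sigma> X) = C \<cdot>\<^sub>H X" "bot_edge D (\<sigma> X) = X \<cdot>\<^sub>H C"
    "left_edge D (\<sigma> X) = \<one>\<^bsub>ver D\<^esub>" "right_edge D (\<sigma> X) = \<one>\<^bsub>ver D\<^esub>"
  using braid_boundary[OF assms] by (auto simp: has_boundary_def)

lemma crossing_edges [simp]:
  assumes "U \<in> carrier (ver D)"
  shows "\<chi> U \<in> cells D" "top_edge D (\<chi> U) = C" "bot_edge D (\<chi> U) = C"
    "left_edge D (\<chi> U) = U" "right_edge D (\<chi> U) = U"
  using crossing_boundary[OF assms] by (auto simp: has_boundary_def)

lemma slides_idh: "X \<in> carrier (hor D) \<Longrightarrow> slides (idh D X)"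
  by (simp add: slides_def crossing_one hcomp_idh)

lemma slides_idv: "U \<in> carrier (ver D) \<Longrightarrow> slides (idv D U)"
  by (simp add: slides_def braid_one)

text \<open>\<open>braid_mult\<close> splits the braidings on products, and the crossing of the
  shared edge, produced by sliding past \<open>a\<close>, is the one consumed by sliding past
  \<open>b\<close>.\<close>

lemma slides_hcomp:
  assumes "slides a" "slides b" and adj: "right_edge D a = left_edge D b"
  shows "slides (a \<triangleright> b)"
proof -
  have [simp]: "a \<in> cells D" "b \<in> cells D" using assms by (auto simp: slides_def)
  define L M R where "L = \<chi> (left_edge D a)" and "M = \<chi> (left_edge D b)" and "R = \<chi> (right_edge D b)"
  have a: "(L \<triangleright> a) \<nabla> \<sigma> (bot_edge D a) = \<sigma> (top_edge D a) \<nabla> (a \<triangleright> M)"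
    and b: "(M \<triangleright> b) \<nabla> \<sigma> (bot_edge D b) = \<sigma> (top_edge D b) \<nabla> (b \<triangleright> R)"
    using assms by (auto simp: slides_def L_def M_def R_def)
  have [simp]: "L \<in> cells D" "M \<in> cells D" "R \<in> cells D" "top_edge D L = C" "bot_edge D L = C"
    "top_edge D M = C" "bot_edge D M = C" "top_edge D R = C" "bot_edge D R = C"
    "left_edge D L = left_edge D a" "right_edge D L = left_edge D a"
    "left_edge D M = left_edge D b" "right_edge D M = left_edge D b"
    "left_edge D R = right_edge D b" "right_edge D R = right_edge D b"
    by (auto simp: L_def M_def R_def)
  note [simp] = adj H.m_assoc
  let ?Ta = "idh D (top_edge D a)" and ?Ba = "idh D (bot_edge D a)"
  let ?Tb = "idh D (top_edge D b)" and ?Bb = "idh D (bot_edge D b)"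
  let ?sTa = "\<sigma> (top_edge D a)" and ?sBa = "\<sigma> (bot_edge D a)"
  let ?sTb = "\<sigma> (top_edge D b)" and ?sBb = "\<sigma> (bot_edge D b)"
  have "(L \<triangleright> (a \<triangleright> b)) \<nabla> \<sigma> (bot_edge D (a \<triangleright> b)) =
      ((L \<triangleright> a \<triangleright> b) \<nabla> (?sBa \<triangleright> ?Bb)) \<nabla> (?Ba \<triangleright> ?sBb)"
    by (simp add: braid_mult vcomp_assoc hcomp_assoc)
  \<comment> \<open>The identity below \<open>b\<close> lets interchange isolate the sliding
    equation of \<open>a\<close>.\<close>
  also have "(L \<triangleright> a \<triangleright> b) \<nabla> (?sBa \<triangleright> ?Bb) = ((L \<triangleright> a) \<nabla> ?sBa) \<triangleright> (b \<nabla> ?Bb)"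
    by (subst interchange) auto
  also have "\<dots> = (?sTa \<nabla> (a \<triangleright> M)) \<triangleright> (?Tb \<nabla> b)"
    by (simp add: a)
  also have "\<dots> = (?sTa \<triangleright> ?Tb) \<nabla> (a \<triangleright> M \<triangleright> b)"
    by (subst interchange) auto
  also have "\<dots> \<nabla> (?Ba \<triangleright> ?sBb) = (?sTa \<triangleright> ?Tb) \<nabla> ((a \<triangleright> (M \<triangleright> b)) \<nabla> (?Ba \<triangleright> ?sBb))"
    by (simp add: vcomp_assoc hcomp_assoc)
  \<comment> \<open>Now \<open>a\<close> is padded below, which isolates the sliding equation of
    \<open>b\<close>.\<close>
  also have "(a \<triangleright> (M \<triangleright> b)) \<nabla> (?Ba \<triangleright> ?sBb) = (a \<nabla> ?Ba) \<triangleright> ((M \<triangleright> b) \<nabla> ?sBb)"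
    by (subst interchange) auto
  also have "\<dots> = (?Ta \<nabla> a) \<triangleright> (?sTb \<nabla> (b \<triangleright> R))"
    by (simp add: b)
  also have "\<dots> = (?Ta \<triangleright> ?sTb) \<nabla> (a \<triangleright> (b \<triangleright> R))"
    by (subst interchange) auto
  also have "(?sTa \<triangleright> ?Tb) \<nabla> \<dots> = \<sigma> (top_edge D (a \<triangleright> b)) \<nabla> ((a \<triangleright> b) \<triangleright> R)"
    by (simp add: braid_mult vcomp_assoc hcomp_assoc)
  finally show ?thesis by (simp add: slides_def L_def R_def)
qed

text \<open>The braiding moves upwards, first through \<open>b\<close> and then through
  \<open>a\<close>; \<open>crossing_mult\<close> stacks the crossings on each side.\<close>

lemma slides_vcomp:
  assumes "slides a" "slides b" and adj: "bot_edge D a = top_edge D b"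
  shows "slides (a \<nabla> b)"
proof -
  have [simp]: "a \<in> cells D" "b \<in> cells D" using assms by (auto simp: slides_def)
  define L R L' R' where "L = \<chi> (left_edge D a)" and "R = \<chi> (right_edge D a)"
    and "L' = \<chi> (left_edge D b)" and "R' = \<chi> (right_edge D b)"
  have a: "(L \<triangleright> a) \<nabla> \<sigma> (bot_edge D a) = \<sigma> (top_edge D a) \<nabla> (a \<triangleright> R)"
    and b: "(L' \<triangleright> b) \<nabla> \<sigma> (bot_edge D b) = \<sigma> (top_edge D b) \<nabla> (b \<triangleright> R')"
    using assms by (auto simp: slides_def L_def R_def L'_def R'_def)
  have [simp]: "L \<in> cells D" "R \<in> cells D" "top_edge D L = C" "bot_edge D L = C"
    "top_edge D R = C" "bot_edge D R = C" "L' \<in> cells D" "R' \<in> cells D" "top_edge D L' = C"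
    "bot_edge D L' = C" "top_edge D R' = C" "bot_edge D R' = C"
    "left_edge D L = left_edge D a" "right_edge D L = left_edge D a"
    "left_edge D R = right_edge D a" "right_edge D R = right_edge D a"
    "left_edge D L' = left_edge D b" "right_edge D L' = left_edge D b"
    "left_edge D R' = right_edge D b" "right_edge D R' = right_edge D b"
    by (auto simp: L_def R_def L'_def R'_def)
  note [simp] = adj
  have "((L \<nabla> L') \<triangleright> (a \<nabla> b)) \<nabla> \<sigma> (bot_edge D b) = (L \<triangleright> a) \<nabla> ((L' \<triangleright> b) \<nabla> \<sigma> (bot_edge D b))"
    by (simp add: interchange vcomp_assoc)
  also have "\<dots> = ((L \<triangleright> a) \<nabla> \<sigma> (bot_edge D a)) \<nabla> (b \<triangleright> R')"
    by (simp add: b vcomp_assoc)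
  also have "\<dots> = \<sigma> (top_edge D a) \<nabla> ((a \<nabla> b) \<triangleright> (R \<nabla> R'))"
    by (subst a) (simp add: interchange vcomp_assoc)
  finally show ?thesis
    by (simp add: slides_def crossing_mult L_def R_def L'_def R'_def)
qed

lemma trivial_cell_commutes:
  assumes "slides h" "trivial_cell h"
  shows "h \<triangleright> idh D C = idh D C \<triangleright> h"
  using assms trivial_cell_edges[OF assms(2)] by (simp add: slides_def crossing_one braid_one)

text \<open>The crossing turns the edge into \<open>X\<close> by \<open>r\<close>, braids it past
  \<open>C\<close> by \<open>\<tau>\<close> and turns it out again by \<open>s\<close>. Placed
  beside either corner, it brings the opposite corner next to it: yanking removes the pair, and the
  remaining \<open>\<tau>\<close> cancels against \<open>\<sigma> X\<close>.\<close>

lemma slides_white: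
  assumes X: "X \<in> carrier (hor D)"
    and r: "has_boundary D r \<one>\<^bsub>hor D\<^esub> X U \<one>\<^bsub>ver D\<^esub>"
    and s: "has_boundary D s X \<one>\<^bsub>hor D\<^esub> \<one>\<^bsub>ver D\<^esub> U"
    and \<tau>: "has_boundary D \<tau> (X \<cdot>\<^sub>H C) (C \<cdot>\<^sub>H X) \<one>\<^bsub>ver D\<^esub> \<one>\<^bsub>ver D\<^esub>"
    and yank: "s \<triangleright> r = idh D X"
    and inv: "\<sigma> X \<nabla> \<tau> = idh D (C \<cdot>\<^sub>H X)" "\<tau> \<nabla> \<sigma> X = idh D (X \<cdot>\<^sub>H C)"
    and \<chi>: "\<chi> U = (r \<triangleright> idh D C) \<nabla> \<tau> \<nabla> (idh D C \<triangleright> s)"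
  shows "slides r" "slides s"
proof -
  note [simp] = X r[unfolded has_boundary_def] s[unfolded has_boundary_def] \<tau>[unfolded has_boundary_def]
  have U [simp]: "U \<in> carrier (ver D)"
    using edges_in_carrier(3)[of r] by (simp del: edges_in_carrier)
  \<comment> \<open>Padding \<open>r\<close> above aligns it with the last layer of the crossing, so
    that \<open>s\<close> and \<open>r\<close> become adjacent.\<close>
  have "\<chi> U \<triangleright> r = ((r \<triangleright> idh D C) \<nabla> \<tau> \<nabla> (idh D C \<triangleright> s)) \<triangleright> (idh D \<one>\<^bsub>hor D\<^esub> \<nabla> r)"
    by (simp add: \<chi>)
  also have "\<dots> = ((r \<triangleright> idh D C) \<nabla> \<tau>) \<nabla> (idh D C \<triangleright> (s \<triangleright> r))"
    by (subst interchange) (auto simp: hcomp_assoc)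
  also have "\<dots> = (r \<triangleright> idh D C) \<nabla> \<tau>"
    by (simp add: yank hcomp_idh)
  finally show "slides r"
    by (simp add: slides_def crossing_one braid_one vcomp_assoc inv)
  \<comment> \<open>Here \<open>s\<close> is padded below, to meet \<open>r\<close> in the first
    layer.\<close>
  have "s \<triangleright> \<chi> U = (s \<nabla> idh D \<one>\<^bsub>hor D\<^esub>) \<triangleright> ((r \<triangleright> idh D C) \<nabla> (\<tau> \<nabla> (idh D C \<triangleright> s)))"
    by (simp add: \<chi> vcomp_assoc)
  also have "\<dots> = ((s \<triangleright> r) \<triangleright> idh D C) \<nabla> (\<tau> \<nabla> (idh D C \<triangleright> s))"
    by (subst interchange) (auto simp: hcomp_assoc)
  also have "\<dots> = \<tau> \<nabla> (idh D C \<triangleright> s)"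
    by (simp add: yank hcomp_idh)
  finally show "slides s"
    by (simp add: slides_def crossing_one braid_one vcomp_assoc[symmetric] inv)
qed

text \<open>The edge runs from right to left, so its crossing contains \<open>\<sigma> X\<close>
  itself: after yanking, both sides of \<open>slides\<close> coincide.\<close>

lemma slides_black:
  assumes X: "X \<in> carrier (hor D)"
    and r: "has_boundary D r \<one>\<^bsub>hor D\<^esub> X \<one>\<^bsub>ver D\<^esub> U"
    and s: "has_boundary D s X \<one>\<^bsub>hor D\<^esub> U \<one>\<^bsub>ver D\<^esub>"
    and yank: "r \<triangleright> s = idh D X"
    and \<chi>: "\<chi> U = (idh D C \<triangleright> r) \<nabla> \<sigma> X \<nabla> (s \<triangleright> idh D C)"
  shows "slides r" "slides s"
proof -
  note [simp] = X r[unfolded has_boundary_def] s[unfolded has_boundary_def]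
  have U [simp]: "U \<in> carrier (ver D)"
    using edges_in_carrier(3)[of s] by (simp del: edges_in_carrier)
  have "r \<triangleright> \<chi> U = (idh D \<one>\<^bsub>hor D\<^esub> \<nabla> r) \<triangleright> ((idh D C \<triangleright> r) \<nabla> \<sigma> X \<nabla> (s \<triangleright> idh D C))"
    by (simp add: \<chi>)
  also have "\<dots> = ((idh D C \<triangleright> r) \<nabla> \<sigma> X) \<nabla> ((r \<triangleright> s) \<triangleright> idh D C)"
    by (subst interchange) (auto simp: hcomp_assoc)
  also have "\<dots> = (idh D C \<triangleright> r) \<nabla> \<sigma> X"
    by (simp add: yank hcomp_idh)
  finally show "slides r"
    by (simp add: slides_def crossing_one braid_one)
  have "\<chi> U \<triangleright> s = ((idh D C \<triangleright> r) \<nabla> (\<sigma> X \<nabla> (s \<triangleright> idh D C))) \<triangleright> (s \<nabla> idh D \<one>\<^bsub>hor D\<^esub>)"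
    by (simp add: \<chi> vcomp_assoc)
  also have "\<dots> = (idh D C \<triangleright> (r \<triangleright> s)) \<nabla> (\<sigma> X \<nabla> (s \<triangleright> idh D C))"
    by (subst interchange) (auto simp: hcomp_assoc)
  also have "\<dots> = \<sigma> X \<nabla> (s \<triangleright> idh D C)"
    by (simp add: yank hcomp_idh)
  finally show "slides s"
    by (simp add: slides_def crossing_one braid_one)
qed

end

section \<open>The free cornering\<close>

context symmetric_strict_monoidal_category
begin

sublocale O: monoid "obj A" by (rule obj_monoid)
sublocale F: single_object_double_category "free_cornering A"
  by (rule single_object_double_category_free_cornering)

text \<open>The hexagon at two unit objects makes this braiding idempotent, and
  \<open>braid_involutive\<close> makes it invertible; an invertible idempotent is an
  identity.\<close>

lemma braid_one_right:
  assumes C: "C \<in> carrier (obj A)"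
  shows "braid A C \<one>\<^bsub>obj A\<^esub> = ident A C"
proof -
  let ?b = "braid A C \<one>\<^bsub>obj A\<^esub>" and ?b' = "braid A \<one>\<^bsub>obj A\<^esub> C"
  have b: "?b \<in> homset A C C" "?b' \<in> homset A C C"
    using braid_hom[of C "\<one>\<^bsub>obj A\<^esub>"] braid_hom[of "\<one>\<^bsub>obj A\<^esub>" C] C by simp_all
  then have "?b = comp A ?b ?b"
    using braid_hexagon[of C "\<one>\<^bsub>obj A\<^esub>" "\<one>\<^bsub>obj A\<^esub>"] C
    by (simp add: homset_def tens_unit_left tens_unit_right)
  moreover have "comp A ?b ?b' = ident A C"
    using braid_involutive[of C "\<one>\<^bsub>obj A\<^esub>"] C by simp
  ultimately show ?thesis
    using comp_assoc[OF b(1) b(1) b(2)] comp_ident_right[OF b(1)] by simp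
qed

section \<open>Cells of the free cornering as classes of terms, and their crossings\<close>

abbreviation cls where "cls \<equiv> cell_class A"

lemma cls_eqI: "cell_eq A s t \<Longrightarrow> cls s = cls t"
  using cell_eq_boundary cell_class_eq_iff by blast

lemma cls_in_cells: "wf_term A t \<Longrightarrow> cls t \<in> cells (free_cornering A)"
  by (auto simp: free_cornering_simps)

lemma cls_has_boundary:
  assumes "wf_term A t"
  shows "has_boundary (free_cornering A) (cls t) (term_top A t) (term_bot A t) (term_left t) (term_right t)"
  using assms by (simp add: has_boundary_def free_cornering_simps(4-) cls_in_cells)

lemma ver_free_cornering:
  "carrier (ver (free_cornering A)) = lists (carrier (obj A) \<times> UNIV)"
  "\<one>\<^bsub>ver (free_cornering A)\<^esub> = []" "U \<otimes>\<^bsub>ver (free_cornering A)\<^esub> W = U @ W"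
  by (auto simp: free_cornering_simps free_edge_monoid_def)

text \<open>White edges run from left to right and black ones from right to left, so the braiding is
  \<open>braid A X C\<close> in one case and \<open>braid A C X\<close> in the other. These are the
  forms of \<open>\<chi> U\<close> that \<open>slides_white\<close> and \<open>slides_black\<close>
  require.\<close>

definition gen_crossing :: "'o \<Rightarrow> 'o \<times> polarity \<Rightarrow> ('o, 'm) cell_term" where
  "gen_crossing C = (\<lambda>(X, p). case p of
     White \<Rightarrow> (RWhite X \<parallel> IdH C) \<div> Box (braid A X C) \<div> (IdH C \<parallel> SWhite X)
   | Black \<Rightarrow> (IdH C \<parallel> RBlack X) \<div> Box (braid A C X) \<div> (SBlack X \<parallel> IdH C))"

text \<open>Generators are stacked in order above the identity on \<open>C\<close>. The empty edge
  thus gives literally \<open>IdH C\<close>, while compatibility with \<open>@\<close> holds only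
  modulo \<open>cell_eq\<close>.\<close>

primrec edge_crossing :: "'o \<Rightarrow> 'o vedge \<Rightarrow> ('o, 'm) cell_term" where
  "edge_crossing C [] = IdH C"
| "edge_crossing C (g # U) = gen_crossing C g \<div> edge_crossing C U"

section \<open>Transfer of equations from \<open>A\<close> to boxes\<close>

lemma box_vcomp:
  assumes "f \<in> homset A X Y" "g \<in> homset A Y Z"
  shows "F.vc (cls (Box f)) (cls (Box g)) = cls (Box (comp A f g))"
  using assms cls_eqI[OF cell_eq.box_comp[OF assms]]
  by (subst vcomp_cell_class) (auto simp: homset_def)

lemma box_hcomp:
  assumes "f \<in> arr A" "g \<in> arr A"
  shows "F.hc (cls (Box f)) (cls (Box g)) = cls (Box (tens A f g))"
  using assms cls_eqI[OF cell_eq.box_tens[OF assms]]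
  by (subst hcomp_cell_class) auto

text \<open>With identities rewritten as boxes, an equation of \<open>A\<close> mixing braidings and
  identities carries over as one equation of boxes.\<close>

lemma idh_eq_box: "X \<in> carrier (obj A) \<Longrightarrow> idh (free_cornering A) X = cls (Box (ident A X))"
  using cls_eqI[OF cell_eq.box_ident[of X A]] by (simp add: free_cornering_simps)

lemma braid_arr [simp]:
  assumes "X \<in> carrier (obj A)" "Y \<in> carrier (obj A)"
  shows "braid A X Y \<in> arr A" "src A (braid A X Y) = X \<otimes>\<^bsub>obj A\<^esub> Y"
    "tgt A (braid A X Y) = Y \<otimes>\<^bsub>obj A\<^esub> X"
  using braid_hom[OF assms] by (auto simp: homset_def)

lemma gen_crossing_edges:
  assumes "C \<in> carrier (obj A)" "fst g \<in> carrier (obj A)"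
  shows "wf_term A (gen_crossing C g)" "term_top A (gen_crossing C g) = C"
    "term_bot A (gen_crossing C g) = C" "term_left (gen_crossing C g) = [g]"
    "term_right (gen_crossing C g) = [g]"
  using assms by (cases g; cases "snd g"; simp add: gen_crossing_def)+

lemma edge_crossing_edges:
  assumes "C \<in> carrier (obj A)" "U \<in> lists (carrier (obj A) \<times> UNIV)"
  shows "wf_term A (edge_crossing C U) \<and> term_top A (edge_crossing C U) = C \<and>
    term_bot A (edge_crossing C U) = C \<and> term_left (edge_crossing C U) = U \<and>
    term_right (edge_crossing C U) = U"
  using assms(2,1) by (induction U) (auto simp: gen_crossing_edges)

lemma cls_edge_crossing_singleton:
  assumes "C \<in> carrier (obj A)" "fst g \<in> carrier (obj A)"
  shows "cls (edge_crossing C [g]) = cls (gen_crossing C g)"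
  using cls_eqI[OF cell_eq.vunit_right[OF gen_crossing_edges(1)[OF assms]]]
  by (simp add: gen_crossing_edges[OF assms])

lemma cls_edge_crossing_append:
  assumes "C \<in> carrier (obj A)" "U \<in> lists (carrier (obj A) \<times> UNIV)"
    "W \<in> lists (carrier (obj A) \<times> UNIV)"
  shows "cls (edge_crossing C (U @ W)) = cls (edge_crossing C U \<div> edge_crossing C W)"
  using assms(2)
proof (induction U)
  case Nil
  then show ?case
    using cls_eqI[OF cell_eq.sym[OF cell_eq.vunit_left[of A "edge_crossing C W"]]]
      edge_crossing_edges[of C W] assms by simp
next
  case (Cons g U)
  then have U: "U \<in> lists (carrier (obj A) \<times> UNIV)" and g: "fst g \<in> carrier (obj A)" by auto
  note e = gen_crossing_edges[OF assms(1) g] edge_crossing_edges[OF assms(1) U]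
    edge_crossing_edges[OF assms(1) assms(3)] edge_crossing_edges[OF assms(1), of "U @ W"]
  \<comment> \<open>Class equality is turned back into \<open>cell_eq\<close>, to which congruence
    under \<open>gen_crossing C g\<close> applies.\<close>
  have "cell_eq A (edge_crossing C (U @ W)) (edge_crossing C U \<div> edge_crossing C W)"
    using Cons.IH cell_class_eq_iff e U assms(3) by simp
  then have "cls (gen_crossing C g \<div> edge_crossing C (U @ W)) =
      cls (gen_crossing C g \<div> (edge_crossing C U \<div> edge_crossing C W))"
    using e U assms(3) by (intro cls_eqI cell_eq.vcong cell_eq.refl) auto
  also have "\<dots> = cls (gen_crossing C g \<div> edge_crossing C U \<div> edge_crossing C W)"
    using e U assms(3) by (intro cls_eqI cell_eq.sym[OF cell_eq.vassoc]) auto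
  finally show ?case by simp
qed

text \<open>\<open>\<sigma>\<close> is the boxed braiding with \<open>C\<close>. Its two laws are
  \<open>braid_one_right\<close> and the hexagon; those of \<open>\<chi>\<close> come from the
  recursion of \<open>edge_crossing\<close> and from
  \<open>cls_edge_crossing_append\<close>.\<close>

lemma crossing_free_cornering:
  assumes C: "C \<in> carrier (obj A)"
  shows "crossing (free_cornering A) C (\<lambda>X. cls (Box (braid A C X))) (\<lambda>U. cls (edge_crossing C U))"
proof
  show "C \<in> carrier (hor (free_cornering A))"
    using C by (simp add: free_cornering_simps)
  show "cls (Box (braid A C \<one>\<^bsub>hor (free_cornering A)\<^esub>)) = idh (free_cornering A) C"
    using C by (simp add: free_cornering_simps(1) braid_one_right idh_eq_box)
  show "cls (edge_crossing C \<one>\<^bsub>ver (free_cornering A)\<^esub>) = idh (free_cornering A) C"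
    by (simp add: ver_free_cornering free_cornering_simps(8))
next
  fix X assume "X \<in> carrier (hor (free_cornering A))"
  then have X: "X \<in> carrier (obj A)" by (simp add: free_cornering_simps)
  then show "has_boundary (free_cornering A) (cls (Box (braid A C X)))
      (C \<otimes>\<^bsub>hor (free_cornering A)\<^esub> X) (X \<otimes>\<^bsub>hor (free_cornering A)\<^esub> C)
      \<one>\<^bsub>ver (free_cornering A)\<^esub> \<one>\<^bsub>ver (free_cornering A)\<^esub>"
    using cls_has_boundary[of "Box (braid A C X)"] C
    by (simp add: ver_free_cornering free_cornering_simps(1))
  fix Y assume "Y \<in> carrier (hor (free_cornering A))"
  then have Y: "Y \<in> carrier (obj A)" by (simp add: free_cornering_simps)
  have idX: "ident A X \<in> homset A X X" and idY: "ident A Y \<in> homset A Y Y"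
    using ident_hom X Y by auto
  \<comment> \<open>The two factors of the hexagon, typed so that \<open>box_vcomp\<close> can fuse
    their boxes.\<close>
  have f: "tens A (braid A C X) (ident A Y) \<in>
      homset A (C \<otimes>\<^bsub>obj A\<^esub> X \<otimes>\<^bsub>obj A\<^esub> Y) (X \<otimes>\<^bsub>obj A\<^esub> C \<otimes>\<^bsub>obj A\<^esub> Y)"
    using tens_hom[OF braid_hom[OF C X] idY] .
  have g: "tens A (ident A X) (braid A C Y) \<in>
      homset A (X \<otimes>\<^bsub>obj A\<^esub> C \<otimes>\<^bsub>obj A\<^esub> Y) (X \<otimes>\<^bsub>obj A\<^esub> (Y \<otimes>\<^bsub>obj A\<^esub> C))"
    using tens_hom[OF idX braid_hom[OF C Y]] C X Y by (simp add: O.m_assoc)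
  show "cls (Box (braid A C (X \<otimes>\<^bsub>hor (free_cornering A)\<^esub> Y))) =
      F.vc
        (F.hc (cls (Box (braid A C X))) (idh (free_cornering A) Y))
        (F.hc (idh (free_cornering A) X) (cls (Box (braid A C Y))))"
    using braid_hexagon[OF C X Y] box_vcomp[OF f g] idX idY C X Y
    by (simp add: free_cornering_simps(1) idh_eq_box box_hcomp homset_def)
next
  fix U assume "U \<in> carrier (ver (free_cornering A))"
  then have U: "U \<in> lists (carrier (obj A) \<times> UNIV)" by (simp add: ver_free_cornering)
  show "has_boundary (free_cornering A) (cls (edge_crossing C U)) C C U U"
    using cls_has_boundary[of "edge_crossing C U"] edge_crossing_edges[OF C U] by simp
  fix W assume "W \<in> carrier (ver (free_cornering A))"
  then have W: "W \<in> lists (carrier (obj A) \<times> UNIV)" by (simp add: ver_free_cornering)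
  show "cls (edge_crossing C (U \<otimes>\<^bsub>ver (free_cornering A)\<^esub> W)) =
      F.vc (cls (edge_crossing C U)) (cls (edge_crossing C W))"
    using cls_edge_crossing_append[OF C U W] edge_crossing_edges[OF C U] edge_crossing_edges[OF C W]
    by (simp add: ver_free_cornering vcomp_cell_class)
qed

section \<open>Sliding for every cell of the free cornering\<close>

lemma slides_corners:
  assumes C: "C \<in> carrier (obj A)" and X: "X \<in> carrier (obj A)"
  defines "S \<equiv> crossing.slides (free_cornering A)
      (\<lambda>X. cls (Box (braid A C X))) (\<lambda>U. cls (edge_crossing C U))"
  shows "S (cls (RWhite X))" "S (cls (SWhite X))" "S (cls (RBlack X))" "S (cls (SBlack X))"
proof -
  interpret C: crossing "free_cornering A" C "\<lambda>X. cls (Box (braid A C X))" "\<lambda>U. cls (edge_crossing C U)"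
    by (rule crossing_free_cornering[OF C])
  note bd = has_boundary_def free_cornering_simps(1,4-) cls_in_cells ver_free_cornering
  \<comment> \<open>Symmetry enters here: taken at \<open>C\<close> and \<open>X\<close> in both
    orders, this makes \<open>braid A X C\<close> the inverse \<open>\<tau>\<close> demanded by
    \<open>slides_white\<close>.\<close>
  have inv: "F.vc (cls (Box (braid A Y Z))) (cls (Box (braid A Z Y))) =
      idh (free_cornering A) (Y \<otimes>\<^bsub>obj A\<^esub> Z)"
    if "Y \<in> carrier (obj A)" "Z \<in> carrier (obj A)" for Y Z
    using box_vcomp[OF braid_hom braid_hom] braid_involutive that by (simp add: idh_eq_box)
  have w: "F.hc (cls (SWhite X)) (cls (RWhite X)) = idh (free_cornering A) X"
    using cls_eqI[OF cell_eq.yank_white_h[OF X]] X by (simp add: hcomp_cell_class free_cornering_simps)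
  have b: "F.hc (cls (RBlack X)) (cls (SBlack X)) = idh (free_cornering A) X"
    using cls_eqI[OF cell_eq.yank_black_h[OF X]] X by (simp add: hcomp_cell_class free_cornering_simps)
  have "cls (edge_crossing C [(X, White)]) =
      F.vc (F.vc
        (F.hc (cls (RWhite X)) (idh (free_cornering A) C)) (cls (Box (braid A X C))))
        (F.hc (idh (free_cornering A) C) (cls (SWhite X)))"
    using C X cls_edge_crossing_singleton[of C "(X, White)"]
    by (simp add: gen_crossing_def free_cornering_simps hcomp_cell_class vcomp_cell_class)
  note white = C.slides_white[where \<tau> = "cls (Box (braid A X C))", OF _ _ _ _ w _ _ this]
  show "S (cls (RWhite X))" "S (cls (SWhite X))"
    unfolding S_def using C X inv by (auto intro!: white simp: bd)
  have "cls (edge_crossing C [(X, Black)]) =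
      F.vc (F.vc
        (F.hc (idh (free_cornering A) C) (cls (RBlack X))) (cls (Box (braid A C X))))
        (F.hc (cls (SBlack X)) (idh (free_cornering A) C))"
    using C X cls_edge_crossing_singleton[of C "(X, Black)"]
    by (simp add: gen_crossing_def free_cornering_simps hcomp_cell_class vcomp_cell_class)
  note black = C.slides_black[OF _ _ _ b this]
  show "S (cls (RBlack X))" "S (cls (SBlack X))"
    unfolding S_def using C X by (auto intro!: black simp: bd)
qed

text \<open>\<open>slides\<close> is a property of the class, so induction on a representing term
  suffices: generators and identities slide, and both compositions preserve sliding.\<close>

lemma slides_cls:
  assumes C: "C \<in> carrier (obj A)" and t: "wf_term A t"
  shows "crossing.slides (free_cornering A)
    (\<lambda>X. cls (Box (braid A C X))) (\<lambda>U. cls (edge_crossing C U)) (cls t)"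
proof -
  interpret C: crossing "free_cornering A" C "\<lambda>X. cls (Box (braid A C X))" "\<lambda>U. cls (edge_crossing C U)"
    by (rule crossing_free_cornering[OF C])
  show ?thesis
    using t
  proof (induction t)
    case (Box f)
    then have f: "f \<in> homset A (src A f) (tgt A f)" "src A f \<in> carrier (obj A)"
        "tgt A f \<in> carrier (obj A)"
      by (auto simp: homset_def src_closed tgt_closed)
    note id = ident_hom[OF C]
    \<comment> \<open>Naturality of the braiding at the identity of \<open>C\<close> and
      \<open>f\<close>, read in boxes.\<close>
    have "F.vc (cls (Box (tens A (ident A C) f))) (cls (Box (braid A C (tgt A f)))) =
        F.vc (cls (Box (braid A C (src A f)))) (cls (Box (tens A f (ident A C))))"
      using box_vcomp[OF tens_hom[OF id f(1)] braid_hom[OF C f(3)]]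
        box_vcomp[OF braid_hom[OF C f(2)] tens_hom[OF f(1) id]] braid_natural[OF id f(1)] by simp
    \<comment> \<open>Both side edges of a box are empty, so its crossings are the identity on
      \<open>C\<close>; written as a box, that identity tensors with \<open>f\<close>.\<close>
    moreover have "cls (edge_crossing C []) = cls (Box (ident A C))"
      using idh_eq_box[OF C] by (simp add: free_cornering_simps)
    ultimately show ?case
      using Box id by (auto simp: C.slides_def free_cornering_simps box_hcomp homset_def simp del: edge_crossing.simps)
  next
    case (IdH X)
    then show ?case using C.slides_idh[of X] by (simp add: free_cornering_simps)
  next
    case (IdV U)
    then show ?case using C.slides_idv[of U] by (simp add: free_cornering_simps)
  next
    case (HComp s t)
    then show ?case
      using C.slides_hcomp[of "cls s" "cls t"] by (simp add: free_cornering_simps hcomp_cell_class)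
  next
    case (VComp s t)
    then show ?case
      using C.slides_vcomp[of "cls s" "cls t"] by (simp add: free_cornering_simps vcomp_cell_class)
  qed (use C slides_corners in auto)
qed

section \<open>Commutation of trivial cells with identities on vertical edges\<close>

lemma trivial_cell_spatial:
  assumes h: "F.trivial_cell h" and U: "U \<in> carrier (ver (free_cornering A))"
  shows "F.vc h (idv (free_cornering A) U) =
    F.vc (idv (free_cornering A) U) h"
proof -
  note hd = F.trivial_cell_edges[OF h]
  obtain t where t: "h = cls t" "wf_term A t"
    using hd(1) by (auto simp: free_cornering_simps)
  \<comment> \<open>Sliding past \<open>C\<close> supplies the hypothesis \<open>comm\<close> for
    passing through corners.\<close>
  have comm: "F.hc h (idh (free_cornering A) C) =
      F.hc (idh (free_cornering A) C) h" if C: "C \<in> carrier (obj A)" for C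
    using crossing.trivial_cell_commutes[OF crossing_free_cornering[OF C]] slides_cls[OF C t(2)] h t(1)
    by simp
  note bd = has_boundary_def free_cornering_simps(1,4-) cls_in_cells ver_free_cornering
  have gen: "F.vc h (idv (free_cornering A) [(C, p)]) =
      F.vc (idv (free_cornering A) [(C, p)]) h" if C: "C \<in> carrier (obj A)" for C p
  proof (cases p)
    case White
    \<comment> \<open>Vertical yanking factors the identity through the horizontal edge
      \<open>C\<close>.\<close>
    have "idv (free_cornering A) [(C, p)] =
        F.vc (cls (RWhite C)) (cls (SWhite C))"
      using cls_eqI[OF cell_eq.yank_white_v[OF C]] C White
      by (simp add: vcomp_cell_class free_cornering_simps)
    then show ?thesis
      using F.trivial_cell_through_white[OF h _ _ _ comm[OF C], of "cls (RWhite C)" _ "cls (SWhite C)"] C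
      by (simp add: bd)
  next
    case Black
    have "idv (free_cornering A) [(C, p)] =
        F.vc (cls (RBlack C)) (cls (SBlack C))"
      using cls_eqI[OF cell_eq.yank_black_v[OF C]] C Black
      by (simp add: vcomp_cell_class free_cornering_simps)
    then show ?thesis
      using F.trivial_cell_through_black[OF h _ _ _ comm[OF C], of "cls (RBlack C)" _ "cls (SBlack C)"] C
      by (simp add: bd)
  qed
  from U have "U \<in> lists (carrier (obj A) \<times> UNIV)" by (simp add: ver_free_cornering)
  then show ?thesis
  proof (induction U)
    case Nil
    \<comment> \<open>The identity on the empty edge is also the identity on the horizontal unit,
      hence neutral for vertical composition with \<open>h\<close>.\<close>
    show ?case
      using hd F.vcomp_idh_left[OF hd(1,2)] F.vcomp_idh_right[OF hd(1,3)] F.idh_one_eq_idv_one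
      by (simp add: ver_free_cornering)
  next
    case (Cons g U)
    then have g: "[g] \<in> carrier (ver (free_cornering A))" and U: "U \<in> carrier (ver (free_cornering A))"
      and C: "fst g \<in> carrier (obj A)"
      by (auto simp: ver_free_cornering)
    let ?g = "idv (free_cornering A) [g]" and ?U = "idv (free_cornering A) U"
    note e = hd F.idv_edges[OF g] F.idv_edges[OF U]
    have *: "idv (free_cornering A) (g # U) = F.vc ?g ?U"
      using F.vcomp_idv[OF g U] by (simp add: ver_free_cornering)
    \<comment> \<open>\<open>h\<close> passes the head by the generator case and the tail by the
      induction hypothesis.\<close>
    have "F.vc h (F.vc ?g ?U) =
        F.vc (F.vc h ?g) ?U"
      using e by (simp add: F.vcomp_assoc)
    also have "F.vc h ?g = F.vc ?g h"
      using gen[OF C, of "snd g"] by simp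
    also have "F.vc (F.vc ?g h) ?U =
        F.vc ?g (F.vc ?U h)"
      using e Cons.IH by (simp add: F.vcomp_assoc)
    also have "\<dots> = F.vc (F.vc ?g ?U) h"
      using e by (simp add: F.vcomp_assoc)
    finally show ?case by (simp add: *)
  qed
qed

end

theorem lemma6p2:
  fixes A :: "('o, 'm) symmetric_monoidal_data"
  assumes "symmetric_strict_monoidal_category A"
  shows "spatial_monoidal_category (horizontal_cells (free_cornering A))"
proof -
  interpret symmetric_strict_monoidal_category A by (rule assms)
  interpret HC: strict_monoidal_category "horizontal_cells (free_cornering A)"
    by (rule F.strict_monoidal_category_horizontal_cells)
  show ?thesis
  proof
    fix U h
    assume "U \<in> carrier (obj (horizontal_cells (free_cornering A)))"
      and "h \<in> homset (horizontal_cells (free_cornering A))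
        \<one>\<^bsub>obj (horizontal_cells (free_cornering A))\<^esub> \<one>\<^bsub>obj (horizontal_cells (free_cornering A))\<^esub>"
    \<comment> \<open>All four edges of \<open>h\<close> are trivial: top and bottom because it is
      an arrow of \<open>horizontal_cells\<close>, left and right by its source and target.\<close>
    then show "tens (horizontal_cells (free_cornering A)) h (ident (horizontal_cells (free_cornering A)) U) =
        tens (horizontal_cells (free_cornering A)) (ident (horizontal_cells (free_cornering A)) U) h"
      using trivial_cell_spatial[of h U]
      by (auto simp: horizontal_cells_def homset_def F.trivial_cell_def has_boundary_def)
  qed
qed

end
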